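(* Let $q\ge1$, $n\ge1$, and consider a transitive element $(S,X_i,\pi_i)$ of $(q+2)\text{-OA}(n)$ (a transitive set of $q$ MOLS of order $n$). Let $(G,H_i)_{i=1}^{q+2}$ be a group packet in $(q+2)\text{-GP}(n)$, with common pairwise intersection $K$, whose associated orthogonal array $G/K\subset\prod_iG/H_i$ is isotopic to $(S,X_i,\pi_i)$ ($G$ need not be the autotopy group). Let $p$ be a prime and $a\ge0$ with $p^a\mid n$ and $p^{a+1}\nmid n$. If $p\nmid |K|$, then $q\le p^a-1$.
   Context: An element of $(q+2)\text{-OA}(n)$ is $(S,X_i,\pi_i)_{i=1}^{q+2}$ with $|X_i|=n$ and $\pi_i\colon S\to X_i$ such that $\pi_i\times\pi_j\colon S\to X_i\times X_j$ is bijective for all $i\ne j$. An isotopy is a collection of bijections $\sigma\colon S\to S'$, $\sigma_i\colon X_i\to X'_i$ with $\pi'_i\sigma=\sigma_i\pi_i$. Regarding $S\subset\prod_iX_i$, the autotopy group is $\{(\sigma_i)\in\prod_i\mathrm{Sym}(X_i):(\sigma_i)(S)=S\}$ and the array is transitive if this group acts transitively on $S$. A group packet in $(q+2)\text{-GP}(n)$ is $(G,H_i)_{i=1}^{q+2}$ with $G$ a group, $H_i\le G$, such that there is a subgroup $K$ with $H_i\cap H_j=K$ for all $i\ne j$ and $[G:H_i]=[H_i:K]=n$. Its associated orthogonal array is $S=G/K$, $X_i=G/H_i$, $\pi_i(gK)=gH_i$.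
   Formalization: The formal theorem assumes a ≥ 1 instead of a ≥ 0: for a = 0 the claim would read q ≤ 0 against q ≥ 1, and it fails e.g. for G = (Z/3)^2 with three lines as H_i, K trivial, n = 3, q = 1, p = 2. *)

theory Defs
  imports "HOL-Algebra.Group_Action" "HOL-Algebra.Product_Groups" "HOL-Algebra.Left_Coset"
    "HOL-Computational_Algebra.Primes"
begin

section \<open>Orthogonal arrays\<close>

record ('s, 'x) array =
  points :: "'s set"
  symbols :: "nat \<Rightarrow> 'x set"
  proj :: "nat \<Rightarrow> 's \<Rightarrow> 'x"

definition orthogonal_array :: "nat \<Rightarrow> nat \<Rightarrow> ('s, 'x) array \<Rightarrow> bool" where
  "orthogonal_array k n A \<longleftrightarrow>
     (\<forall>i\<in>{1..k}. finite (symbols A i) \<and> card (symbols A i) = n \<and>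
        proj A i \<in> points A \<rightarrow> symbols A i) \<and>
     (\<forall>i\<in>{1..k}. \<forall>j\<in>{1..k}. i \<noteq> j \<longrightarrow>
        bij_betw (\<lambda>s. (proj A i s, proj A j s)) (points A) (symbols A i \<times> symbols A j))"

definition isotopic :: "nat \<Rightarrow> ('s, 'x) array \<Rightarrow> ('t, 'y) array \<Rightarrow> bool" where
  "isotopic k A B \<longleftrightarrow>
     (\<exists>\<sigma> \<tau>. bij_betw \<sigma> (points A) (points B) \<and>
        (\<forall>i\<in>{1..k}. bij_betw (\<tau> i) (symbols A i) (symbols B i) \<and>
           (\<forall>s\<in>points A. proj B i (\<sigma> s) = \<tau> i (proj A i s))))"

text \<open>The image of the point set under \<open>s \<mapsto> (\<pi>\<^sub>i(s))\<^sub>i\<close>, i.e. \<open>S\<close> regarded as a subset of the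
  product of the \<open>X\<^sub>i\<close>.\<close>

definition rows :: "nat \<Rightarrow> ('s, 'x) array \<Rightarrow> (nat \<Rightarrow> 'x) set" where
  "rows k A = (\<lambda>s. \<lambda>i\<in>{1..k}. proj A i s) ` points A"

definition coord_act :: "nat \<Rightarrow> (nat \<Rightarrow> 'x \<Rightarrow> 'x) \<Rightarrow> (nat \<Rightarrow> 'x) \<Rightarrow> (nat \<Rightarrow> 'x)" where
  "coord_act k \<sigma> x = (\<lambda>i\<in>{1..k}. \<sigma> i (x i))"

definition autotopy_group :: "nat \<Rightarrow> ('s, 'x) array \<Rightarrow> (nat \<Rightarrow> 'x \<Rightarrow> 'x) monoid" where
  "autotopy_group k A =
     (let P = product_group {1..k} (\<lambda>i. BijGroup (symbols A i))
      in P\<lparr>carrier := {\<sigma> \<in> carrier P. coord_act k \<sigma> ` rows k A = rows k A}\<rparr>)"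

definition transitive_array :: "nat \<Rightarrow> ('s, 'x) array \<Rightarrow> bool" where
  "transitive_array k A \<longleftrightarrow>
     transitive_action (autotopy_group k A) (rows k A)
       (\<lambda>\<sigma>. restrict (coord_act k \<sigma>) (rows k A))"

lemma carrier_autotopy_group:
  "carrier (autotopy_group k A) =
     {\<sigma> \<in> (\<Pi>\<^sub>E i\<in>{1..k}. Bij (symbols A i)). coord_act k \<sigma> ` rows k A = rows k A}"
  by (simp add: autotopy_group_def Let_def BijGroup_def)

lemma rows_subset:
  assumes "\<And>i. i \<in> {1..k} \<Longrightarrow> proj A i \<in> points A \<rightarrow> symbols A i"
  shows "rows k A \<subseteq> (\<Pi>\<^sub>E i\<in>{1..k}. symbols A i)"
  using assms by (fastforce simp: rows_def)

lemma coord_act_mult: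
  assumes "\<sigma> \<in> (\<Pi>\<^sub>E i\<in>{1..k}. Bij (symbols A i))" "\<tau> \<in> (\<Pi>\<^sub>E i\<in>{1..k}. Bij (symbols A i))"
    and "x \<in> (\<Pi>\<^sub>E i\<in>{1..k}. symbols A i)"
  shows "coord_act k (\<sigma> \<otimes>\<^bsub>product_group {1..k} (\<lambda>i. BijGroup (symbols A i))\<^esub> \<tau>) x =
         coord_act k \<sigma> (coord_act k \<tau> x)"
proof
  fix i
  show "coord_act k (\<sigma> \<otimes>\<^bsub>product_group {1..k} (\<lambda>i. BijGroup (symbols A i))\<^esub> \<tau>) x i =
         coord_act k \<sigma> (coord_act k \<tau> x) i"
  proof (cases "i \<in> {1..k}")
    case True
    then have "\<sigma> i \<in> Bij (symbols A i)" "\<tau> i \<in> Bij (symbols A i)" "x i \<in> symbols A i"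
      using assms by (auto dest!: PiE_mem)
    with True show ?thesis
      by (simp add: coord_act_def BijGroup_def compose_def)
  qed (auto simp: coord_act_def)
qed

lemma coord_act_inj:
  assumes "\<sigma> \<in> (\<Pi>\<^sub>E i\<in>{1..k}. Bij (symbols A i))"
  shows "inj_on (coord_act k \<sigma>) (\<Pi>\<^sub>E i\<in>{1..k}. symbols A i)"
proof (rule inj_onI)
  fix x y
  assume x: "x \<in> (\<Pi>\<^sub>E i\<in>{1..k}. symbols A i)" and y: "y \<in> (\<Pi>\<^sub>E i\<in>{1..k}. symbols A i)"
    and eq: "coord_act k \<sigma> x = coord_act k \<sigma> y"
  show "x = y"
  proof (rule PiE_ext[OF x y])
    fix i assume i: "i \<in> {1..k}"
    have "\<sigma> i (x i) = \<sigma> i (y i)"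
      using fun_cong[OF eq, of i] i by (simp add: coord_act_def)
    moreover have "inj_on (\<sigma> i) (symbols A i)"
      using PiE_mem[OF assms i] by (simp add: Bij_def bij_betw_def)
    ultimately show "x i = y i"
      using PiE_mem[OF x i] PiE_mem[OF y i] by (auto dest: inj_onD)
  qed
qed

lemma group_action_autotopy_group:
  assumes "\<And>i. i \<in> {1..k} \<Longrightarrow> proj A i \<in> points A \<rightarrow> symbols A i"
  shows "group_action (autotopy_group k A) (rows k A)
           (\<lambda>\<sigma>. restrict (coord_act k \<sigma>) (rows k A))"
proof -
  let ?P = "product_group {1..k} (\<lambda>i. BijGroup (symbols A i))"
  let ?H = "carrier (autotopy_group k A)"
  let ?X = "\<Pi>\<^sub>E i\<in>{1..k}. symbols A i"
  have P: "group ?P"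
    by (simp add: group_BijGroup)
  have car: "carrier ?P = (\<Pi>\<^sub>E i\<in>{1..k}. Bij (symbols A i))"
    by (simp add: BijGroup_def)
  have R: "rows k A \<subseteq> ?X"
    using assms by (rule rows_subset)
  have eq: "autotopy_group k A = ?P\<lparr>carrier := ?H\<rparr>"
    by (simp add: autotopy_group_def Let_def)
  have HP: "?H \<subseteq> carrier ?P"
    unfolding carrier_autotopy_group car by blast
  have one: "coord_act k \<one>\<^bsub>?P\<^esub> x = x" if "x \<in> ?X" for x
  proof
    fix i show "coord_act k \<one>\<^bsub>?P\<^esub> x i = x i"
      using that PiE_mem[OF that, of i] PiE_arb[OF that, of i]
      by (cases "i \<in> {1..k}") (auto simp: coord_act_def BijGroup_def)
  qed
  have mult: "coord_act k (\<sigma> \<otimes>\<^bsub>?P\<^esub> \<tau>) x = coord_act k \<sigma> (coord_act k \<tau> x)"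
    if "\<sigma> \<in> carrier ?P" "\<tau> \<in> carrier ?P" "x \<in> rows k A" for \<sigma> \<tau> x
    using that R car by (intro coord_act_mult) auto
  have im: "coord_act k \<sigma> ` rows k A = rows k A" if "\<sigma> \<in> ?H" for \<sigma>
    using that by (simp add: carrier_autotopy_group)
  have memI: "\<sigma> \<in> ?H" if "\<sigma> \<in> carrier ?P" "coord_act k \<sigma> ` rows k A = rows k A" for \<sigma>
    using that by (simp add: autotopy_group_def Let_def)
  have sub: "subgroup ?H ?P"
  proof (rule group.subgroupI[OF P HP])
    have "coord_act k \<one>\<^bsub>?P\<^esub> ` rows k A = rows k A"
      using image_cong[OF refl one[OF subsetD[OF R]], of "rows k A"] by (simp only: image_ident)
    then have "\<one>\<^bsub>?P\<^esub> \<in> ?H"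
      using monoid.one_closed[OF group.is_monoid[OF P]] by (rule memI[rotated])
    then show "?H \<noteq> {}" by blast
  next
    fix \<sigma> assume s: "\<sigma> \<in> ?H"
    then have sP: "\<sigma> \<in> carrier ?P" using HP by blast
    have iP: "inv\<^bsub>?P\<^esub> \<sigma> \<in> carrier ?P"
      using P sP by (rule group.inv_closed)
    have "coord_act k (inv\<^bsub>?P\<^esub> \<sigma>) (coord_act k \<sigma> x) = x" if x: "x \<in> rows k A" for x
      using mult[OF iP sP x] one[OF subsetD[OF R x]] by (simp only: group.l_inv[OF P sP])
    then have "coord_act k (inv\<^bsub>?P\<^esub> \<sigma>) ` (coord_act k \<sigma> ` rows k A) = rows k A"
      unfolding image_image by (simp only: image_ident cong: image_cong)
    then show "inv\<^bsub>?P\<^esub> \<sigma> \<in> ?H"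
      using iP by (intro memI) (simp_all only: im[OF s])
  next
    fix \<sigma> \<tau> assume s: "\<sigma> \<in> ?H" and t: "\<tau> \<in> ?H"
    then have sP: "\<sigma> \<in> carrier ?P" and tP: "\<tau> \<in> carrier ?P" using HP by blast+
    have "coord_act k (\<sigma> \<otimes>\<^bsub>?P\<^esub> \<tau>) ` rows k A = coord_act k \<sigma> ` (coord_act k \<tau> ` rows k A)"
      unfolding image_image by (rule image_cong[OF refl mult[OF sP tP]])
    then show "\<sigma> \<otimes>\<^bsub>?P\<^esub> \<tau> \<in> ?H"
      using monoid.m_closed[OF group.is_monoid[OF P] sP tP]
      by (intro memI) (simp_all only: im[OF s] im[OF t])
  qed
  have grp: "group (autotopy_group k A)"
    using group.subgroup_imp_group[OF P sub] eq by simp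
  have bij: "restrict (coord_act k \<sigma>) (rows k A) \<in> Bij (rows k A)" if s: "\<sigma> \<in> ?H" for \<sigma>
  proof -
    have "inj_on (coord_act k \<sigma>) (rows k A)"
      using coord_act_inj[of \<sigma> k A] s R
      by (auto simp: carrier_autotopy_group intro: inj_on_subset)
    then show ?thesis
      using im[OF s] by (simp add: Bij_def bij_betw_def inj_on_restrict_eq)
  qed
  have "(\<lambda>\<sigma>. restrict (coord_act k \<sigma>) (rows k A)) \<in> hom (autotopy_group k A) (BijGroup (rows k A))"
  proof (rule homI)
    fix \<sigma> assume "\<sigma> \<in> ?H"
    then show "restrict (coord_act k \<sigma>) (rows k A) \<in> carrier (BijGroup (rows k A))"
      using bij by (simp add: BijGroup_def)
  next
    fix \<sigma> \<tau> assume s: "\<sigma> \<in> ?H" and t: "\<tau> \<in> ?H"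
    have m: "\<sigma> \<otimes>\<^bsub>autotopy_group k A\<^esub> \<tau> = \<sigma> \<otimes>\<^bsub>?P\<^esub> \<tau>"
      by (simp add: autotopy_group_def Let_def)
    have "restrict (coord_act k (\<sigma> \<otimes>\<^bsub>?P\<^esub> \<tau>)) (rows k A) =
      compose (rows k A) (restrict (coord_act k \<sigma>) (rows k A)) (restrict (coord_act k \<tau>) (rows k A))"
    proof
      fix x
      show "restrict (coord_act k (\<sigma> \<otimes>\<^bsub>?P\<^esub> \<tau>)) (rows k A) x =
        compose (rows k A) (restrict (coord_act k \<sigma>) (rows k A)) (restrict (coord_act k \<tau>) (rows k A)) x"
      proof (cases "x \<in> rows k A")
        case True
        then have "coord_act k \<tau> x \<in> rows k A" using im[OF t] by blast
        with True show ?thesis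
          using mult[OF subsetD[OF HP s] subsetD[OF HP t] True]
          by (simp add: compose_def del: mult_product_group)
      qed (simp add: compose_def)
    qed
    then show "restrict (coord_act k (\<sigma> \<otimes>\<^bsub>autotopy_group k A\<^esub> \<tau>)) (rows k A) =
      restrict (coord_act k \<sigma>) (rows k A) \<otimes>\<^bsub>BijGroup (rows k A)\<^esub> restrict (coord_act k \<tau>) (rows k A)"
      using bij[OF s] bij[OF t] by (simp only: m) (simp add: BijGroup_def)
  qed
  then show ?thesis
    using grp group_BijGroup by (simp add: group_action_def group_hom_def group_hom_axioms_def)
qed

lemma transitive_array_iff:
  assumes "orthogonal_array k n A"
  shows "transitive_array k A \<longleftrightarrow>
    (\<forall>x\<in>rows k A. \<forall>y\<in>rows k A. \<exists>\<sigma>\<in>carrier (autotopy_group k A). coord_act k \<sigma> x = y)"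
  using group_action_autotopy_group[of k A] assms
  by (auto simp: transitive_array_def transitive_action_def transitive_action_axioms_def
      orthogonal_array_def)

section \<open>Group packets\<close>

definition has_index :: "('g, 'm) monoid_scheme \<Rightarrow> 'g set \<Rightarrow> nat \<Rightarrow> bool" where
  "has_index G H n \<longleftrightarrow> finite (lcosets\<^bsub>G\<^esub> H) \<and> card (lcosets\<^bsub>G\<^esub> H) = n"

definition common_intersection :: "nat \<Rightarrow> (nat \<Rightarrow> 'g set) \<Rightarrow> 'g set \<Rightarrow> bool" where
  "common_intersection k H K \<longleftrightarrow> (\<forall>i\<in>{1..k}. \<forall>j\<in>{1..k}. i \<noteq> j \<longrightarrow> H i \<inter> H j = K)"

definition group_packet ::
    "nat \<Rightarrow> nat \<Rightarrow> ('g, 'm) monoid_scheme \<Rightarrow> (nat \<Rightarrow> 'g set) \<Rightarrow> bool" where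
  "group_packet k n G H \<longleftrightarrow>
     group G \<and> (\<forall>i\<in>{1..k}. subgroup (H i) G) \<and>
     (\<exists>K. subgroup K G \<and> common_intersection k H K \<and>
        (\<forall>i\<in>{1..k}. has_index G (H i) n \<and> has_index (G\<lparr>carrier := H i\<rparr>) K n))"

text \<open>The map \<open>gK \<mapsto> gH\<close>, well defined for \<open>K \<subseteq> H\<close>.\<close>

definition coset_map :: "('g, 'm) monoid_scheme \<Rightarrow> 'g set \<Rightarrow> 'g set \<Rightarrow> 'g set \<Rightarrow> 'g set" where
  "coset_map G K H C = (THE D. \<exists>g\<in>carrier G. C = g <#\<^bsub>G\<^esub> K \<and> D = g <#\<^bsub>G\<^esub> H)"

definition packet_array ::
    "('g, 'm) monoid_scheme \<Rightarrow> (nat \<Rightarrow> 'g set) \<Rightarrow> 'g set \<Rightarrow> ('g set, 'g set) array" where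
  "packet_array G H K =
     \<lparr>points = lcosets\<^bsub>G\<^esub> K, symbols = (\<lambda>i. lcosets\<^bsub>G\<^esub> (H i)), proj = (\<lambda>i. coset_map G K (H i))\<rparr>"

lemma coset_map_eq:
  assumes G: "group G" and K: "subgroup K G" and H: "subgroup H G" and "K \<subseteq> H"
    and g: "g \<in> carrier G"
  shows "coset_map G K H (g <#\<^bsub>G\<^esub> K) = g <#\<^bsub>G\<^esub> H"
  unfolding coset_map_def
proof (rule the_equality)
  show "\<exists>g'\<in>carrier G. g <#\<^bsub>G\<^esub> K = g' <#\<^bsub>G\<^esub> K \<and> g <#\<^bsub>G\<^esub> H = g' <#\<^bsub>G\<^esub> H"
    using g by blast
next
  fix D assume "\<exists>g'\<in>carrier G. g <#\<^bsub>G\<^esub> K = g' <#\<^bsub>G\<^esub> K \<and> D = g' <#\<^bsub>G\<^esub> H"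
  then obtain g' where g': "g' \<in> carrier G" "g <#\<^bsub>G\<^esub> K = g' <#\<^bsub>G\<^esub> K" "D = g' <#\<^bsub>G\<^esub> H"
    by blast
  have "g' \<in> g' <#\<^bsub>G\<^esub> K"
    using group.lcos_self[OF G g'(1) K] .
  then have "g' \<in> g <#\<^bsub>G\<^esub> H"
    using g'(2) \<open>K \<subseteq> H\<close> by (auto simp: l_coset_def)
  then show "D = g <#\<^bsub>G\<^esub> H"
    using group.l_repr_independence[OF G _ g H] g'(3) by simp
qed

end

theory Submission
  imports Defs "HOL-Algebra.Sylow" "HOL-Algebra.Multiplicative_Group"
begin

no_notation (ASCII) subset_mset (infix "<#" 50)

text \<open>A subgroup \<open>P\<close> of order \<open>p\<^sup>2\<^sup>a\<close> acts on the \<open>n\<close> cosets of each \<open>H\<^sub>i\<close>. Since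
  \<open>p\<^sup>a\<^sup>+\<^sup>1\<close> does not divide \<open>n\<close>, some orbit has at most \<open>p\<^sup>a\<close> points, so some coset of \<open>H\<^sub>i\<close> has
  a stabilizer \<open>Q\<^sub>i\<close> in \<open>P\<close> of order at least \<open>p\<^sup>a\<close>. Any coset of \<open>H\<^sub>i\<close> and any coset of \<open>H\<^sub>j\<close> have a
  common representative, so \<open>Q\<^sub>i \<inter> Q\<^sub>j\<close> is conjugate into \<open>K\<close>; being also a \<open>p\<close>-group, it is
  trivial. Hence \<open>q + 2\<close> pairwise disjoint sets of at least \<open>p\<^sup>a - 1\<close> elements fit
  into \<open>P - {1}\<close>.\<close>

section \<open>Left cosets and the translation action on them\<close>

context group
begin

lemma l_coset_eq_iff:
  assumes "subgroup H G" "x \<in> carrier G" "y \<in> carrier G"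
  shows "x <# H = y <# H \<longleftrightarrow> inv x \<otimes> y \<in> H"
proof
  assume "x <# H = y <# H"
  then have "y \<in> x <# H"
    using lcos_self[OF assms(3,1)] by simp
  then show "inv x \<otimes> y \<in> H"
    using subgroup.lcos_module_imp[OF assms(1) is_group assms(2)] by blast
next
  assume "inv x \<otimes> y \<in> H"
  then have "x \<otimes> (inv x \<otimes> y) \<in> x <# H"
    by (auto simp: l_coset_def)
  then have "y \<in> x <# H"
    using assms by (simp add: m_assoc[symmetric])
  then show "x <# H = y <# H"
    using assms by (intro l_repr_independence)
qed

text \<open>The group is the union of its cosets, and each coset is an image of \<open>H\<close>.
  This lets finiteness climb from \<open>K\<close> through \<open>H 1\<close> to \<open>G\<close>,
  so that Lagrange's theorem becomes available.\<close>

lemma finite_carrier_if_finite_lcosets: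
  assumes "subgroup H G" "finite H" "finite (lcosets H)"
  shows "finite (carrier G)"
proof -
  have "finite C" if "C \<in> lcosets H" for C
    using that assms(2) by (auto simp: LCOSETS_def l_coset_def)
  then show ?thesis
    using assms(3) lcosets_part_G[OF assms(1)] by (metis finite_Union)
qed

lemma lcosets_action:
  assumes H: "subgroup H G" and P: "subgroup P G"
  shows "group_action (G\<lparr>carrier := P\<rparr>) (lcosets H) (\<lambda>g. \<lambda>C\<in>lcosets H. g <# C)"
proof -
  let ?\<phi> = "\<lambda>g. \<lambda>C\<in>lcosets H. g <# C"
  have sub: "C \<subseteq> carrier G" if "C \<in> lcosets H" for C
    using that subgroup.lcosets_carrier[OF H is_group] by blast
  have mem: "g <# C \<in> lcosets H" if "g \<in> carrier G" "C \<in> lcosets H" for g C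
    using that subgroup.subset[OF H] by (auto simp: LCOSETS_def lcos_m_assoc)
  have bij: "?\<phi> g \<in> Bij (lcosets H)" if g: "g \<in> carrier G" for g
  proof -
    have "bij_betw (\<lambda>C. g <# C) (lcosets H) (lcosets H)"
    proof (rule bij_betwI[where g = "\<lambda>C. inv g <# C"])
      show "inv g <# (g <# C) = C" if "C \<in> lcosets H" for C
        using sub[OF that] g by (simp add: lcos_m_assoc lcos_mult_one)
      show "g <# (inv g <# C) = C" if "C \<in> lcosets H" for C
        using sub[OF that] g by (simp add: lcos_m_assoc lcos_mult_one)
    qed (use g mem in auto)
    then show ?thesis
      by (simp add: Bij_def cong: bij_betw_cong)
  qed
  have PG: "P \<subseteq> carrier G"
    using subgroup.subset[OF P] .
  have "?\<phi> \<in> hom (G\<lparr>carrier := P\<rparr>) (BijGroup (lcosets H))"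
  proof (rule homI)
    fix x y assume "x \<in> carrier (G\<lparr>carrier := P\<rparr>)" "y \<in> carrier (G\<lparr>carrier := P\<rparr>)"
    then have x: "x \<in> carrier G" and y: "y \<in> carrier G"
      using PG by auto
    have "?\<phi> (x \<otimes> y) = compose (lcosets H) (?\<phi> x) (?\<phi> y)"
      using x y by (auto simp: compose_def fun_eq_iff mem lcos_m_assoc sub)
    then show "?\<phi> (x \<otimes>\<^bsub>G\<lparr>carrier := P\<rparr>\<^esub> y) = ?\<phi> x \<otimes>\<^bsub>BijGroup (lcosets H)\<^esub> ?\<phi> y"
      using bij[OF x] bij[OF y] by (simp add: BijGroup_def)
  qed (use PG bij in \<open>auto simp: BijGroup_def\<close>)
  then show ?thesis
    using subgroup_imp_group[OF P] group_BijGroup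
    by (simp add: group_action_def group_hom_def group_hom_axioms_def)
qed

text \<open>The stabilizer of a coset \<open>g <# H\<close> is the conjugate of \<open>H\<close> by
  \<open>g\<close>; this turns fixing a coset into membership in a subgroup.\<close>

lemma l_coset_fixed_iff:
  assumes H: "subgroup H G" and x: "x \<in> carrier G" and g: "g \<in> carrier G"
  shows "x <# (g <# H) = g <# H \<longleftrightarrow> inv g \<otimes> x \<otimes> g \<in> H"
proof -
  have "x <# (g <# H) = g <# H \<longleftrightarrow> g <# H = (x \<otimes> g) <# H"
    using subgroup.subset[OF H] x g by (auto simp: lcos_m_assoc)
  then show ?thesis
    using l_coset_eq_iff[OF H g, of "x \<otimes> g"] x g by (simp add: m_assoc)
qed

text \<open>This is orthogonality of the associated array. Pairing the two projections is always
  injective on cosets of \<open>H \<inter> L\<close>, since \<open>inv x \<otimes> y\<close> in both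
  \<open>H\<close> and \<open>L\<close> lies in the intersection; the cardinality hypothesis then
  forces surjectivity.\<close>

lemma common_coset_representative:
  assumes fin: "finite (carrier G)" and H: "subgroup H G" and L: "subgroup L G"
    and card: "card (lcosets (H \<inter> L)) = card (lcosets H) * card (lcosets L)"
    and C: "C \<in> lcosets H" and D: "D \<in> lcosets L"
  obtains g where "g \<in> carrier G" "C = g <# H" "D = g <# L"
proof -
  let ?K = "H \<inter> L"
  have K: "subgroup ?K G"
    using H L by (rule subgroups_Inter_pair)
  \<comment> \<open>The pair of projections \<open>gK \<mapsto> gH\<close> and
    \<open>gK \<mapsto> gL\<close>.\<close>
  define F where "F C = (coset_map G ?K H C, coset_map G ?K L C)" for C
  have F: "F (g <# ?K) = (g <# H, g <# L)" if "g \<in> carrier G" for g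
    using that coset_map_eq[OF is_group K H] coset_map_eq[OF is_group K L]
    by (simp add: F_def)
  have "inj_on F (lcosets ?K)"
  proof (rule inj_onI)
    fix C D assume "C \<in> lcosets ?K" "D \<in> lcosets ?K" and eq: "F C = F D"
    then obtain x y where "x \<in> carrier G" "y \<in> carrier G" "C = x <# ?K" "D = y <# ?K"
      by (auto simp: LCOSETS_def)
    with eq show "C = D"
      using l_coset_eq_iff[OF H, of x y] l_coset_eq_iff[OF L, of x y]
        l_coset_eq_iff[OF K, of x y] by (auto simp: F)
  qed
  then have "card (F ` (lcosets ?K)) = card ((lcosets H) \<times> (lcosets L))"
    using card by (simp add: card_image card_cartesian_product)
  moreover have "F ` (lcosets ?K) \<subseteq> (lcosets H) \<times> (lcosets L)"
    by (auto simp: LCOSETS_def F)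
  moreover have "finite ((lcosets H) \<times> (lcosets L))"
    using fin by (simp add: LCOSETS_def)
  ultimately have "F ` (lcosets ?K) = (lcosets H) \<times> (lcosets L)"
    by (intro card_subset_eq)
  then have "(C, D) \<in> F ` (lcosets ?K)"
    using C D by simp
  then obtain g where "g \<in> carrier G" "(C, D) = F (g <# ?K)"
    by (auto simp: LCOSETS_def)
  then show thesis
    using that F by simp
qed

section \<open>Elements of coprime orders\<close>

lemma coprime_pow_eq_one:
  fixes m n :: nat
  assumes "x \<in> carrier G" "x [^] m = \<one>" "x [^] n = \<one>" "coprime m n"
  shows "x = \<one>"
proof -
  have "ord x dvd m" "ord x dvd n"
    using assms pow_eq_id[OF assms(1)] by simp_all
  then have "ord x = 1"
    using coprime_common_divisor_nat[OF assms(4)] by simp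
  then show ?thesis
    using ord_eq_1[OF assms(1)] by simp
qed

lemma subgroup_pow_card_eq_one:
  assumes K: "subgroup K G" and x: "x \<in> K"
  shows "x [^] card K = \<one>"
proof -
  interpret K: group "G\<lparr>carrier := K\<rparr>"
    using subgroup_imp_group[OF K] .
  have "x [^]\<^bsub>G\<lparr>carrier := K\<rparr>\<^esub> order (G\<lparr>carrier := K\<rparr>) = \<one>\<^bsub>G\<lparr>carrier := K\<rparr>\<^esub>"
    using x by (intro K.pow_order_eq_1) simp
  then show ?thesis
    by (simp add: order_def nat_pow_consistent[symmetric])
qed

text \<open>Conjugation preserves powers, so the conjugate of \<open>x\<close> is killed both by
  \<open>card P\<close> and by \<open>card K\<close>, which are coprime.\<close>

lemma subgroup_inter_conjugate_trivial:
  assumes P: "subgroup P G" and K: "subgroup K G" and cop: "coprime (card P) (card K)"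
    and x: "x \<in> P" and g: "g \<in> carrier G" and conj: "inv g \<otimes> x \<otimes> g \<in> K"
  shows "x = \<one>"
proof -
  have xG: "x \<in> carrier G"
    using subgroup.mem_carrier[OF P x] .
  have "(inv g \<otimes> x \<otimes> g) [^] m = inv g \<otimes> x [^] m \<otimes> g" for m :: nat
  proof (induction m)
    case (Suc m)
    have "g \<otimes> (inv g \<otimes> (x \<otimes> g)) = x \<otimes> g"
      using xG g by (simp add: m_assoc[symmetric])
    then show ?case
      using Suc xG g by (simp add: m_assoc)
  qed (use g in simp)
  then have "(inv g \<otimes> x \<otimes> g) [^] card P = \<one>"
    using subgroup_pow_card_eq_one[OF P x] g by simp
  moreover have "(inv g \<otimes> x \<otimes> g) [^] card K = \<one>"
    using subgroup_pow_card_eq_one[OF K conj] .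
  ultimately have "inv g \<otimes> x \<otimes> g = \<one>"
    using cop xG g coprime_pow_eq_one[of "inv g \<otimes> x \<otimes> g" "card P" "card K"] by simp
  \<comment> \<open>Now \<open>inv g \<otimes> x\<close> is a left inverse of \<open>g\<close>,
    hence equal to \<open>inv g\<close>, and cancelling leaves \<open>x = \<one>\<close>.\<close>
  then have "inv g = inv g \<otimes> x"
    using xG g by (intro inv_equality) simp_all
  then show ?thesis
    using xG g by (simp add: r_cancel_one)
qed

end

section \<open>Orbit sizes and counting\<close>

text \<open>Orbit sizes are powers of \<open>p\<close>. If all exceeded \<open>p ^ a\<close>, each
  would be a multiple of \<open>p ^ (a + 1)\<close>, and so would \<open>card E\<close>, which is
  their sum.\<close>

lemma (in group_action) p_group_small_orbit:
  assumes p: "Factorial_Ring.prime (p :: nat)" and ord: "order G = p ^ m"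
    and fin: "finite E" and ndvd: "\<not> p ^ (a + 1) dvd card E"
  obtains x where "x \<in> E" "card (orbit G \<phi> x) \<le> p ^ a"
proof -
  have "\<exists>x\<in>E. card (orbit G \<phi> x) \<le> p ^ a"
  proof (rule ccontr)
    assume "\<not> ?thesis"
    then have large: "card (orbit G \<phi> x) > p ^ a" if "x \<in> E" for x
      using that by (auto simp: not_le)
    have "p ^ (a + 1) dvd card (orbit G \<phi> x)" if x: "x \<in> E" for x
    proof -
      have "card (orbit G \<phi> x) dvd p ^ m"
        using orbit_stabilizer_theorem[OF x] ord by (metis dvd_triv_left)
      then obtain k where k: "card (orbit G \<phi> x) = p ^ k"
        using p divides_primepow_nat by blast
      then have "a < k"
        using large[OF x] p prime_gt_1_nat power_less_imp_less_exp by metis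
      then show ?thesis
        unfolding k by (intro le_imp_power_dvd) simp
    qed
    then have "p ^ (a + 1) dvd card (\<Union> (orbits G E \<phi>))"
      using fin disjoint_union by (intro dvd_partition) (unfold orbits_coverture, auto simp: orbits_def)
    then show False
      using ndvd by (simp add: orbits_coverture)
  qed
  then show thesis
    using that by blast
qed

text \<open>The packing count behind partial spreads, stated for plain sets: \<open>e\<close> stands
  for the identity, and the sets with \<open>e\<close> removed are disjoint inside
  \<open>P - {e}\<close>.\<close>

lemma partial_spread_bound:
  assumes fin: "finite P" and e: "e \<in> P" and I: "finite I"
    and Q: "\<And>i. i \<in> I \<Longrightarrow> Q i \<subseteq> P" "\<And>i. i \<in> I \<Longrightarrow> m \<le> card (Q i)"
    and disj: "\<And>i j. i \<in> I \<Longrightarrow> j \<in> I \<Longrightarrow> i \<noteq> j \<Longrightarrow> Q i \<inter> Q j \<subseteq> {e}"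
  shows "card I * (m - 1) \<le> card P - 1"
proof -
  have finQ: "finite (Q i)" if "i \<in> I" for i
    using Q(1)[OF that] fin by (rule finite_subset)
  have "card I * (m - 1) = (\<Sum>i\<in>I. m - 1)"
    by simp
  also have "\<dots> \<le> (\<Sum>i\<in>I. card (Q i - {e}))"
  proof (rule sum_mono)
    fix i assume "i \<in> I"
    \<comment> \<open>Whether or not \<open>e\<close> lies in \<open>Q i\<close>, deleting it lowers
      the cardinality by at most one.\<close>
    then show "m - 1 \<le> card (Q i - {e})"
      using Q(2)[of i] diff_card_le_card_Diff[of "{e}" "Q i"] by simp
  qed
  also have "\<dots> = card (\<Union>i\<in>I. Q i - {e})"
    using I finQ disj by (intro card_UN_disjoint[symmetric]) auto
  also have "\<dots> \<le> card (P - {e})"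
    using fin Q(1) by (intro card_mono) auto
  also have "\<dots> = card P - 1"
    using e by simp
  finally show ?thesis .
qed

section \<open>The bound for group packets\<close>

lemma (in group) packet_bound:
  assumes I: "finite I" and H: "\<And>i. i \<in> I \<Longrightarrow> subgroup (H i) G"
    and K: "subgroup K G"
    and int: "\<And>i j. i \<in> I \<Longrightarrow> j \<in> I \<Longrightarrow> i \<noteq> j \<Longrightarrow> H i \<inter> H j = K"
    and fin: "finite (carrier G)"
    and ix: "\<And>i. i \<in> I \<Longrightarrow> card (lcosets (H i)) = n" and ord: "order G = n ^ 2 * card K"
    and p: "Factorial_Ring.prime p" and a: "a \<ge> 1"
    and dvd: "p ^ a dvd n" and ndvd: "\<not> p ^ (a + 1) dvd n" and pK: "\<not> p dvd card K"
  shows "card I \<le> p ^ a + 1"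
proof -
  obtain m where m: "n = p ^ a * m"
    using dvd by blast
  \<comment> \<open>\<open>n\<close> enters \<open>order G\<close> squared, hence the exponent
    \<open>2 * a\<close>. As \<open>p\<close> divides neither \<open>m\<close> nor
    \<open>card K\<close>, the resulting \<open>P\<close> is even a Sylow subgroup.\<close>
  have "order G = p ^ (2 * a) * (m ^ 2 * card K)"
    by (simp add: ord m power_mult_distrib power_mult mult.commute[of 2])
  then obtain P where P: "subgroup P G" and cP: "card P = p ^ (2 * a)"
    using sylow_thm[OF p is_group _ fin] by blast
  have cop: "coprime (card P) (card K)"
    using p pK by (simp add: cP prime_imp_coprime)
  let ?\<phi> = "\<lambda>i g. \<lambda>C\<in>lcosets (H i). g <# C"
  have finP: "finite P"
    using fin subgroup.subset[OF P] by (rule rev_finite_subset)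
  have "\<exists>C\<in>lcosets (H i). p ^ a \<le> card {x \<in> P. x <# C = C}" if i: "i \<in> I" for i
  proof -
    interpret act: group_action "G\<lparr>carrier := P\<rparr>" "lcosets (H i)" "?\<phi> i"
      using lcosets_action[OF H[OF i] P] .
    have oP: "order (G\<lparr>carrier := P\<rparr>) = p ^ (2 * a)"
      by (simp add: order_def cP)
    obtain C where C: "C \<in> lcosets (H i)"
      and small: "card (orbit (G\<lparr>carrier := P\<rparr>) (?\<phi> i) C) \<le> p ^ a"
      by (rule act.p_group_small_orbit[OF p oP, of a])
        (use fin ix[OF i] ndvd in \<open>auto simp: LCOSETS_def\<close>)
    have "stabilizer (G\<lparr>carrier := P\<rparr>) (?\<phi> i) C = {x \<in> P. x <# C = C}"
      using C by (simp add: stabilizer_def)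
    then have "card (orbit (G\<lparr>carrier := P\<rparr>) (?\<phi> i) C) * card {x \<in> P. x <# C = C} = p ^ a * p ^ a"
      using act.orbit_stabilizer_theorem[OF C] oP by (simp add: mult_2 power_add)
    then have "p ^ a * p ^ a \<le> p ^ a * card {x \<in> P. x <# C = C}"
      using mult_le_mono1[OF small, of "card {x \<in> P. x <# C = C}"] by simp
    then show ?thesis
      using C prime_gt_0_nat[OF p] by auto
  qed
  \<comment> \<open>The cosets \<open>C i\<close> are chosen independently of each other; for each
    pair, \<open>triv\<close> moves to a common representative \<open>g\<close>.\<close>
  then obtain C where C: "\<And>i. i \<in> I \<Longrightarrow> C i \<in> lcosets (H i)"
    and large: "\<And>i. i \<in> I \<Longrightarrow> p ^ a \<le> card {x \<in> P. x <# C i = C i}"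
    by metis
  have K0: "card K > 0"
    using pK by (cases "card K") auto
  have triv: "x = \<one>"
    if i: "i \<in> I" and j: "j \<in> I" and ij: "i \<noteq> j" and x: "x \<in> P"
      and fixed: "x <# C i = C i" "x <# C j = C j" for i j x
  proof -
    \<comment> \<open>Cancelling \<open>card K\<close>, which is positive because \<open>p\<close>
      divides 0, gives the \<open>n * n\<close> cosets of \<open>K\<close> that
      \<open>common_coset_representative\<close> asks for.\<close>
    have "card (lcosets K) * card K = n * n * card K"
      using l_lagrange[OF fin K] ord by (simp add: power2_eq_square)
    then have "card (lcosets (H i \<inter> H j)) = card (lcosets (H i)) * card (lcosets (H j))"
      using K0 by (simp add: int[OF i j ij] ix[OF i] ix[OF j])
    then obtain g where g: "g \<in> carrier G" "C i = g <# H i" "C j = g <# H j"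
      by (rule common_coset_representative[OF fin H[OF i] H[OF j] _ C[OF i] C[OF j]])
    have "inv g \<otimes> x \<otimes> g \<in> H i \<inter> H j"
      using fixed l_coset_fixed_iff[OF H[OF i] _ g(1)] l_coset_fixed_iff[OF H[OF j] _ g(1)]
        subgroup.mem_carrier[OF P x] by (simp add: g)
    then show ?thesis
      using subgroup_inter_conjugate_trivial[OF P K cop x g(1)] int[OF i j ij] by simp
  qed
  have "card I * (p ^ a - 1) \<le> card P - 1"
    by (rule partial_spread_bound[where Q = "\<lambda>i. {x \<in> P. x <# C i = C i}" and e = \<one>,
          OF finP subgroup.one_closed[OF P] I])
      (use large triv in auto)
  also have "card P - 1 = (p ^ a + 1) * (p ^ a - 1)"
    unfolding cP mult_2 power_add by (simp add: algebra_simps)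
  finally have "card I * (p ^ a - 1) \<le> (p ^ a + 1) * (p ^ a - 1)" .
  \<comment> \<open>Here \<open>a \<ge> 1\<close> enters: for \<open>a = 0\<close> both sides of the
    inequality vanish and nothing can be cancelled.\<close>
  moreover have "0 < p ^ a - 1"
    using one_less_power[OF prime_gt_1_nat[OF p], of a] a by simp
  ultimately show ?thesis
    by (simp only: mult_le_cancel2)
qed

theorem theorem4p4:
  fixes q n p a :: nat
    and A :: "('s, 'x) array"
    and G :: "('g, 'm) monoid_scheme"
    and H :: "nat \<Rightarrow> 'g set"
    and K :: "'g set"
  assumes "q \<ge> 1" and "n \<ge> 1"
    and "orthogonal_array (q + 2) n A"
    and "transitive_array (q + 2) A"
    and "group_packet (q + 2) n G H"
    and "common_intersection (q + 2) H K"
    and "isotopic (q + 2) (packet_array G H K) A"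
    and "Factorial_Ring.prime p"
    and "a \<ge> 1"
    and "p ^ a dvd n" and "\<not> p ^ (a + 1) dvd n"
    and "\<not> p dvd card K"
  shows "q \<le> p ^ a - 1"
proof -
  let ?I = "{1..q + 2}"
  interpret group G
    using assms(5) by (simp add: group_packet_def)
  obtain K' where K': "subgroup K' G" "common_intersection (q + 2) H K'"
    and H: "\<And>i. i \<in> ?I \<Longrightarrow> subgroup (H i) G"
    and ixG: "\<And>i. i \<in> ?I \<Longrightarrow> has_index G (H i) n"
    and ixH: "\<And>i. i \<in> ?I \<Longrightarrow> has_index (G\<lparr>carrier := H i\<rparr>) K' n"
    using assms(5) unfolding group_packet_def by blast
  have one: "1 \<in> ?I" "2 \<in> ?I"
    by auto
  have K_eq: "H i \<inter> H j = K" if "i \<in> ?I" "j \<in> ?I" "i \<noteq> j" for i j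
    using assms(6) that unfolding common_intersection_def by blast
  \<comment> \<open>The packet hides its intersection \<open>K'\<close> under an existential; as
    there are at least two indices, it must be the given \<open>K\<close>.\<close>
  have "H 1 \<inter> H 2 = K'"
    using bspec[OF bspec[OF K'(2)[unfolded common_intersection_def] one(1)] one(2)] by simp
  then have KK: "K' = K"
    using K_eq[OF one] by simp
  have K: "subgroup K G"
    using K'(1) KK by simp
  \<comment> \<open>An infinite set has \<open>card\<close> 0, which \<open>p\<close> divides, so
    the last hypothesis excludes it.\<close>
  have finK: "finite K"
    using assms(12) by (cases "finite K") auto
  interpret H1: group "G\<lparr>carrier := H 1\<rparr>"
    using subgroup_imp_group[OF H[OF one(1)]] .
  have KH1: "subgroup K (G\<lparr>carrier := H 1\<rparr>)"
    using subgroup_incl[OF K H[OF one(1)]] K_eq[OF one] by auto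
  have ix1: "finite (lcosets\<^bsub>G\<lparr>carrier := H 1\<rparr>\<^esub> K)" "card (lcosets\<^bsub>G\<lparr>carrier := H 1\<rparr>\<^esub> K) = n"
    using ixH[OF one(1)] by (simp_all add: has_index_def KK)
  have finH1: "finite (carrier (G\<lparr>carrier := H 1\<rparr>))"
    by (rule H1.finite_carrier_if_finite_lcosets[OF KH1 finK ix1(1)])
  have ixG1: "finite (lcosets\<^bsub>G\<^esub> (H 1))" "card (lcosets\<^bsub>G\<^esub> (H 1)) = n"
    using ixG[OF one(1)] by (simp_all add: has_index_def)
  have fin: "finite (carrier G)"
    using finite_carrier_if_finite_lcosets[OF H[OF one(1)] _ ixG1(1)] finH1 by simp
  \<comment> \<open>Lagrange along the chain from \<open>K\<close> to \<open>H 1\<close> to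
    \<open>G\<close>, each step of index \<open>n\<close>.\<close>
  have "n * card K = card (H 1)"
    using H1.l_lagrange[OF finH1 KH1] unfolding ix1(2) by (simp add: order_def)
  moreover have "n * card (H 1) = order G"
    using l_lagrange[OF fin H[OF one(1)]] unfolding ixG1(2) .
  ultimately have "order G = n ^ 2 * card K"
    by (simp add: power2_eq_square mult.assoc)
  then have "card ?I \<le> p ^ a + 1"
    using packet_bound[of ?I H K n p a, OF finite_atLeastAtMost H K K_eq fin _ _ assms(8-12)] ixG
    unfolding has_index_def by blast
  then show ?thesis
    by simp
qed

end
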